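(* Let $H:\mathbb R\to\mathbb R$ be smooth with $\|H'\|_\infty<\infty$ and let $\theta\in(0,1]$. For every $L>0$ there exists a constant $C>0$, depending only on $L$ (for the fixed $H$ and $\theta$), such that the following holds. Let $T>0$, let $u_0:\mathbb R\to\mathbb R$ be bounded and Lipschitz with $\|u_0'\|_\infty\le L$, let $h>0$, let $\mathcal P=\{0=t_0<t_1<\dots<t_N=T\}$ be a partition of $[0,T]$, and let $\zeta\in C([0,T];\mathbb R)$ be affine on each $[t_n,t_{n+1}]$ with $$\max_{n=0,\dots,N-1}|\zeta(t_{n+1})-\zeta(t_n)|\le\frac{\theta}{\|H'\|_\infty}\,h .$$ Let $v$ be the viscosity solution of $v_t=H(v_x)\dot\zeta(t)$ in $\mathbb R\times(0,T]$, $v(\cdot,0)=u_0$, and let $v_h(\cdot,0;\zeta,\mathcal P):=u_0$ and $v_h(\cdot,t;\zeta,\mathcal P):=S_h(t,t_n;\zeta)v_h(\cdot,t_n;\zeta,\mathcal P)$ for $n=0,\dots,N-1$ and $t\in(t_n,t_{n+1}]$, where $$S_h(t,s;\zeta)w(x):=w(x)+H\Big(\tfrac{w(x+h)-w(x-h)}{2h}\Big)(\zeta(t)-\zeta(s))+\tfrac\theta2\big(w(x+h)+w(x-h)-2w(x)\big).$$ Then, for all $\epsilon>0$, $$\sup_{(x,t)\in\mathbb R\times[0,T]}|v_h(x,t;\zeta,\mathcal P)-v(x,t)|\le\frac1\epsilon\sum_{n=0}^{N-1}(t_{n+1}-t_n)^2+C\sqrt N\,h+\max_{s,t\in[0,T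]}\Big\{C|\zeta(s)-\zeta(t)|-\frac{|s-t|^2}{2\epsilon}\Big\}.$$
   Context: Since $\dot\zeta$ is constant on each interval of the partition, $v$ is the continuous function which on each $[t_n,t_{n+1}]$ is the usual (Crandall–Lions) viscosity solution of the Hamilton–Jacobi equation $v_t=H(v_x)\,\dot\zeta$ with constant coefficient $\dot\zeta=\frac{\zeta(t_{n+1})-\zeta(t_n)}{t_{n+1}-t_n}$ and initial value $v(\cdot,t_n)$. *)

theory Defs
  imports "HOL-Analysis.Analysis"
begin

definition smooth :: "(real \<Rightarrow> real) \<Rightarrow> bool" where
  "smooth f \<longleftrightarrow> (\<forall>k. ((deriv ^^ k) f) differentiable_on UNIV)"

text \<open>Only meaningful for bounded \<open>f\<close>.\<close>

definition sup_norm :: "(real \<Rightarrow> real) \<Rightarrow> real" where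
  "sup_norm f = (SUP x. \<bar>f x\<bar>)"

definition is_partition :: "real \<Rightarrow> nat \<Rightarrow> (nat \<Rightarrow> real) \<Rightarrow> bool" where
  "is_partition T N p \<longleftrightarrow> p 0 = 0 \<and> p N = T \<and> (\<forall>n<N. p n < p (Suc n))"

definition affine_on_partition :: "nat \<Rightarrow> (nat \<Rightarrow> real) \<Rightarrow> (real \<Rightarrow> real) \<Rightarrow> bool" where
  "affine_on_partition N p \<zeta> \<longleftrightarrow>
     (\<forall>n<N. \<exists>a b. \<forall>t\<in>{p n..p (Suc n)}. \<zeta> t = a * t + b)"

text \<open>Functions of space and time are maps on pairs \<open>(x, t)\<close>.  The functions \<open>\<phi>x\<close> and
  \<open>\<phi>t\<close> are the continuous partial derivatives of \<open>\<phi>\<close>.\<close>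

definition C1_on ::
  "(real \<times> real) set \<Rightarrow> (real \<times> real \<Rightarrow> real) \<Rightarrow> (real \<times> real \<Rightarrow> real)
     \<Rightarrow> (real \<times> real \<Rightarrow> real) \<Rightarrow> bool" where
  "C1_on S \<phi> \<phi>x \<phi>t \<longleftrightarrow>
     continuous_on S \<phi>x \<and> continuous_on S \<phi>t \<and>
     (\<forall>z\<in>S. (\<phi> has_derivative (\<lambda>(k, s). \<phi>x z * k + \<phi>t z * s)) (at z))"

definition has_local_max :: "(real \<times> real \<Rightarrow> real) \<Rightarrow> real \<times> real \<Rightarrow> bool" where
  "has_local_max f z \<longleftrightarrow> (\<forall>\<^sub>F y in nhds z. f y \<le> f z)"

definition has_local_min :: "(real \<times> real \<Rightarrow> real) \<Rightarrow> real \<times> real \<Rightarrow> bool" where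
  "has_local_min f z \<longleftrightarrow> (\<forall>\<^sub>F y in nhds z. f z \<le> f y)"

text \<open>Crandall--Lions sub- and supersolutions of \<open>v\<^sub>t = c H(v\<^sub>x)\<close> in the open strip
  \<open>\<real> \<times> (a, b)\<close>.\<close>

definition viscosity_subsolution ::
  "(real \<Rightarrow> real) \<Rightarrow> real \<Rightarrow> real \<Rightarrow> real \<Rightarrow> (real \<times> real \<Rightarrow> real) \<Rightarrow> bool" where
  "viscosity_subsolution H c a b v \<longleftrightarrow>
     (\<forall>\<phi> \<phi>x \<phi>t z. C1_on (UNIV \<times> {a<..<b}) \<phi> \<phi>x \<phi>t \<and> z \<in> UNIV \<times> {a<..<b} \<and>
        has_local_max (\<lambda>y. v y - \<phi> y) z \<longrightarrow> \<phi>t z \<le> H (\<phi>x z) * c)"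

definition viscosity_supersolution ::
  "(real \<Rightarrow> real) \<Rightarrow> real \<Rightarrow> real \<Rightarrow> real \<Rightarrow> (real \<times> real \<Rightarrow> real) \<Rightarrow> bool" where
  "viscosity_supersolution H c a b v \<longleftrightarrow>
     (\<forall>\<phi> \<phi>x \<phi>t z. C1_on (UNIV \<times> {a<..<b}) \<phi> \<phi>x \<phi>t \<and> z \<in> UNIV \<times> {a<..<b} \<and>
        has_local_min (\<lambda>y. v y - \<phi> y) z \<longrightarrow> H (\<phi>x z) * c \<le> \<phi>t z)"

text \<open>The viscosity solution of the Cauchy problem driven by a path that is affine on each
  partition interval.  No growth condition at infinity is imposed: for Lipschitz \<open>H\<close>,
  finite speed of propagation gives uniqueness among all continuous functions.\<close>

definition is_viscosity_solution ::
  "(real \<Rightarrow> real) \<Rightarrow> (real \<Rightarrow> real) \<Rightarrow> nat \<Rightarrow> (nat \<Rightarrow> real) \<Rightarrow> (real \<Rightarrow> real)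
     \<Rightarrow> (real \<times> real \<Rightarrow> real) \<Rightarrow> bool" where
  "is_viscosity_solution H \<zeta> N p u0 v \<longleftrightarrow>
     continuous_on (UNIV \<times> {p 0..p N}) v \<and>
     (\<forall>x. v (x, p 0) = u0 x) \<and>
     (\<forall>n<N. let c = (\<zeta> (p (Suc n)) - \<zeta> (p n)) / (p (Suc n) - p n) in
        viscosity_subsolution H c (p n) (p (Suc n)) v \<and>
        viscosity_supersolution H c (p n) (p (Suc n)) v)"

definition scheme_step ::
  "(real \<Rightarrow> real) \<Rightarrow> real \<Rightarrow> real \<Rightarrow> (real \<Rightarrow> real) \<Rightarrow> real \<Rightarrow> real
     \<Rightarrow> (real \<Rightarrow> real) \<Rightarrow> real \<Rightarrow> real" where
  "scheme_step H \<theta> h \<zeta> t s w x =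
     w x + H ((w (x + h) - w (x - h)) / (2 * h)) * (\<zeta> t - \<zeta> s)
         + \<theta> / 2 * (w (x + h) + w (x - h) - 2 * w x)"

primrec scheme_at_node ::
  "(real \<Rightarrow> real) \<Rightarrow> real \<Rightarrow> real \<Rightarrow> (real \<Rightarrow> real) \<Rightarrow> (nat \<Rightarrow> real) \<Rightarrow> (real \<Rightarrow> real)
     \<Rightarrow> nat \<Rightarrow> real \<Rightarrow> real" where
  "scheme_at_node H \<theta> h \<zeta> p u0 0 = u0"
| "scheme_at_node H \<theta> h \<zeta> p u0 (Suc n) =
     scheme_step H \<theta> h \<zeta> (p (Suc n)) (p n) (scheme_at_node H \<theta> h \<zeta> p u0 n)"

text \<open>For \<open>t > p 0\<close>, the \<open>n\<close> chosen below is the one with \<open>p n < t \<le> p (Suc n)\<close>; the lemmas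
  \<open>scheme_initial\<close> and \<open>scheme_recursion\<close> are the defining recursion of the scheme.\<close>

definition scheme ::
  "(real \<Rightarrow> real) \<Rightarrow> real \<Rightarrow> real \<Rightarrow> (real \<Rightarrow> real) \<Rightarrow> (nat \<Rightarrow> real) \<Rightarrow> (real \<Rightarrow> real)
     \<Rightarrow> real \<times> real \<Rightarrow> real" where
  "scheme H \<theta> h \<zeta> p u0 = (\<lambda>(x, t).
     if t \<le> p 0 then u0 x
     else let n = (LEAST n. t \<le> p (Suc n))
          in scheme_step H \<theta> h \<zeta> t (p n) (scheme_at_node H \<theta> h \<zeta> p u0 n) x)"

lemma partition_mono:
  assumes "is_partition T N p" "i \<le> j" "j \<le> N"
  shows "p i \<le> p j"
  using assms(2,3)
proof (induction j rule: dec_induct)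
  case (step j)
  then have "p j < p (Suc j)"
    using assms(1) by (auto simp: is_partition_def)
  with step show ?case by simp
qed simp

lemma partition_LEAST:
  assumes P: "is_partition T N p" and n: "n < N" and t: "t \<in> {p n<..p (Suc n)}"
  shows "(LEAST n. t \<le> p (Suc n)) = n"
proof (rule Least_equality)
  show "t \<le> p (Suc n)" using t by simp
  fix m assume m: "t \<le> p (Suc m)"
  show "n \<le> m"
  proof (rule ccontr)
    assume "\<not> n \<le> m"
    then have "p (Suc m) \<le> p n"
      using partition_mono[OF P, of "Suc m" n] n by simp
    with m t show False by simp
  qed
qed

lemma scheme_initial: "scheme H \<theta> h \<zeta> p u0 (x, p 0) = u0 x"
  by (simp add: scheme_def)

lemma scheme_node:
  assumes P: "is_partition T N p" and n: "n \<le> N"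
  shows "scheme H \<theta> h \<zeta> p u0 (x, p n) = scheme_at_node H \<theta> h \<zeta> p u0 n x"
proof (cases n)
  case 0
  then show ?thesis by (simp add: scheme_def)
next
  case (Suc m)
  then have mN: "m < N" using n by simp
  have lt: "p m < p n" using P mN Suc by (auto simp: is_partition_def)
  then have "(LEAST k. p n \<le> p (Suc k)) = m"
    using partition_LEAST[OF P mN, of "p n"] Suc by simp
  moreover have "\<not> p n \<le> p 0"
    using partition_mono[OF P, of 0 m] lt mN by simp
  ultimately show ?thesis using Suc by (simp add: scheme_def)
qed

lemma scheme_recursion:
  assumes P: "is_partition T N p" and n: "n < N" and t: "t \<in> {p n<..p (Suc n)}"
  shows "scheme H \<theta> h \<zeta> p u0 (x, t) =
         scheme_step H \<theta> h \<zeta> t (p n) (\<lambda>y. scheme H \<theta> h \<zeta> p u0 (y, p n)) x"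
proof -
  have "\<not> t \<le> p 0"
    using partition_mono[OF P, of 0 n] t n by simp
  moreover have "(\<lambda>y. scheme H \<theta> h \<zeta> p u0 (y, p n)) = scheme_at_node H \<theta> h \<zeta> p u0 n"
    using scheme_node[OF P] n by (simp add: fun_eq_iff)
  ultimately show ?thesis
    using partition_LEAST[OF P n t] by (simp add: scheme_def)
qed

end

theory Submission
  imports Defs
begin

text \<open>The variables are doubled in space only.  If \<open>v\<^sub>h(x, t\<^sub>n) - v(y, t\<^sub>n) \<le> M + (x - y)\<^sup>2 / (2\<delta>)\<close>
  for all \<open>x\<close>, \<open>y\<close>, then monotonicity of the scheme, applied to paraboloids in \<open>x\<close>, and comparison
  of \<open>v\<close> with an explicit smooth subsolution in \<open>y\<close> give the same inequality at time \<open>t\<^sub>n\<^sub>+\<^sub>1\<close>, with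
  \<open>M\<close> increased by at most \<open>3h\<^sup>2 / (2\<delta>)\<close>.  Initially \<open>M = L\<^sup>2\<delta> / 2\<close> is admissible, and the choice
  \<open>\<delta> = \<surd>N h\<close> yields the error \<open>C \<surd>N h\<close>, without the two remaining nonnegative terms of the
  claimed bound.  The opposite inequality follows by passing to \<open>-v\<close> and \<open>-H(-p)\<close>.\<close>

section \<open>Comparison of a supersolution with C1 subsolutions\<close>

lemma pos_part_square_has_derivative:
  "((\<lambda>r::real. (max 0 r)\<^sup>2) has_real_derivative 2 * max 0 r) (at r)"
proof -
  consider "r < 0" | "r > 0" | "r = 0" by linarith
  then show ?thesis
  proof cases
    case 1
    have "((\<lambda>r::real. 0) has_real_derivative 2 * max 0 r) (at r)"
      using 1 by simp
    then show ?thesis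
      by (rule has_field_derivative_transform_within_open[where S = "{..<0}"]) (use 1 in auto)
  next
    case 2
    have "((\<lambda>r::real. r\<^sup>2) has_real_derivative 2 * max 0 r) (at r)"
      using 2 by (auto intro!: derivative_eq_intros)
    then show ?thesis
      by (rule has_field_derivative_transform_within_open[where S = "{0<..}"]) (use 2 in auto)
  next
    case 3
    have "((\<lambda>k::real. (max 0 k)\<^sup>2 / k) \<longlongrightarrow> 0) (at 0)"
    proof (rule Lim_null_comparison[OF always_eventually])
      show "\<forall>k. norm ((max 0 k)\<^sup>2 / k) \<le> \<bar>k\<bar>"
        by (auto simp: max_def power2_eq_square)
      show "((\<lambda>k::real. \<bar>k\<bar>) \<longlongrightarrow> 0) (at 0)"
        by (rule tendsto_rabs_zero) (rule tendsto_ident_at)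
    qed
    then show ?thesis
      by (simp add: 3 DERIV_def)
  qed
qed

text \<open>The solution may grow arbitrarily fast at infinity, so the test function is localised by a
  penalty that vanishes inside a backward cone of dependence and is itself compatible with the
  equation; a second penalty, blowing up at time \<open>b\<close>, keeps the minimum away from the final
  time and makes the subsolution strict.\<close>

lemma C1_subsolution_le_supersolution:
  fixes H :: "real \<Rightarrow> real" and v \<phi> \<phi>x \<phi>t :: "real \<times> real \<Rightarrow> real"
  assumes lip: "\<And>p q. \<bar>H p - H q\<bar> \<le> K * \<bar>p - q\<bar>"
    and cont: "continuous_on (UNIV \<times> {a..b}) v"
    and super: "viscosity_supersolution H c a b v"
    and C1: "C1_on UNIV \<phi> \<phi>x \<phi>t"
    and sub: "\<And>x t. a < t \<Longrightarrow> t < b \<Longrightarrow> \<phi>t (x, t) \<le> H (\<phi>x (x, t)) * c"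
    and init: "\<And>x. \<phi> (x, a) \<le> v (x, a)"
    and "a < b" and t: "t \<in> {a..b}"
  shows "\<phi> (x, t) \<le> v (x, t)"
proof -
  have K0: "K \<ge> 0"
    using lip[of 1 0] by simp
  have cont\<phi>: "continuous_on S \<phi>" for S
    using C1 unfolding C1_on_def
    by (meson UNIV_I continuous_at_imp_continuous_on has_derivative_continuous)
  have inner: "\<phi> (x, r) \<le> v (x, r)" if r: "a < r" "r < b" for r
  proof (rule ccontr)
    assume neg: "\<not> \<phi> (x, r) \<le> v (x, r)"
    \<comment> \<open>With this choice the barrier \<open>\<eta> / (b - s)\<close> equals half of
      the assumed violation at \<open>(x, r)\<close>, so subtracting it from \<open>\<phi>\<close>
      still leaves a violation there.\<close>
    define \<eta> where "\<eta> = (\<phi> (x, r) - v (x, r)) * (b - r) / 2"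
    have \<eta>: "\<eta> > 0"
      using neg r by (simp add: \<eta>_def)
    \<comment> \<open>\<open>k\<close> bounds the speed of propagation, and \<open>R\<close> is the
      distance covered at this speed during the whole interval.\<close>
    define k where "k = K * \<bar>c\<bar>"
    define R where "R = k * (b - a)"
    have k0: "k \<ge> 0" using K0 by (simp add: k_def)
    have kR: "k * (s - a) \<le> R" if "s \<le> b" for s
      using that k0 by (simp add: R_def mult_left_mono)
    have R0: "R \<ge> 0" using kR[of a] \<open>a < b\<close> by simp
    have "compact ((\<lambda>z. v z - \<phi> z) ` ({x - R - 1..x + R + 1} \<times> {a..b}))"
      by (intro compact_continuous_image continuous_on_diff cont\<phi>
          continuous_on_subset[OF cont] compact_Times) auto
    then have "bounded ((\<lambda>z. v z - \<phi> z) ` ({x - R - 1..x + R + 1} \<times> {a..b}))"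
      by (rule compact_imp_bounded)
    \<comment> \<open>\<open>\<Lambda>\<close> bounds the difference on a box reaching one unit
      beyond the base of the cone. It also serves as the weight of the penalty, so a penalty with
      \<open>(mp z)\<^sup>2 + (mm z)\<^sup>2 \<ge> 1\<close> outweighs any negative value of
      \<open>v - \<phi>\<close> in the box.\<close>
    then obtain \<Lambda> where \<Lambda>: "\<Lambda> > 0"
      and bnd: "\<And>y s. \<lbrakk>x - R - 1 \<le> y; y \<le> x + R + 1; a \<le> s; s \<le> b\<rbrakk> \<Longrightarrow>
        \<bar>v (y, s) - \<phi> (y, s)\<bar> \<le> \<Lambda>"
      unfolding bounded_pos by fastforce
    \<comment> \<open>The first bound keeps \<open>r\<close> below \<open>b - e\<close>; the second
      makes the barrier exceed \<open>\<Lambda>\<close> at time \<open>b - e\<close>.\<close>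
    define e where "e = min ((b - r) / 2) (\<eta> / (2 * \<Lambda>))"
    have "e > 0"
      using r \<eta> \<Lambda> by (simp add: e_def)
    moreover have "e \<le> (b - r) / 2" "e \<le> \<eta> / (2 * \<Lambda>)"
      unfolding e_def by (rule min.cobounded1, rule min.cobounded2)
    ultimately have e: "e > 0" "e \<le> (b - r) / 2" "e \<le> \<eta> / (2 * \<Lambda>)" .
    have \<eta>e: "\<Lambda> < \<eta> / e"
    proof -
      have "2 * (\<Lambda> * e) \<le> \<eta>"
        using e(3) \<Lambda> by (simp add: field_simps)
      moreover have "0 < \<Lambda> * e" using e(1) \<Lambda> by simp
      ultimately have "\<Lambda> * e < \<eta>" by linarith
      then show ?thesis
        using e(1) by (simp add: pos_less_divide_eq)
    qed
    \<comment> \<open>Both terms vanish exactly on the cone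
      \<open>\<bar>y - x\<bar> \<le> k * (b - s)\<close>, which contains \<open>(x, r)\<close>. They
      enter squared because the squared positive part is C1, as a test function has to be.\<close>
    define mp where "mp z = max 0 (fst z - x + k * (snd z - a) - R)" for z :: "real \<times> real"
    define mm where "mm z = max 0 (x - fst z + k * (snd z - a) - R)" for z :: "real \<times> real"
    define \<psi> where "\<psi> z = \<phi> z - \<Lambda> * ((mp z)\<^sup>2 + (mm z)\<^sup>2) - \<eta> / (b - snd z)" for z
    define \<psi>x where "\<psi>x z = \<phi>x z - 2 * \<Lambda> * (mp z - mm z)" for z
    define \<psi>t where "\<psi>t z = \<phi>t z - 2 * \<Lambda> * k * (mp z + mm z) - \<eta> / (b - snd z)\<^sup>2" for z
    have cont_m: "continuous_on S mp" "continuous_on S mm" for S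
      unfolding mp_def mm_def by (intro continuous_intros)+
    have deriv_m:
      "((\<lambda>z. (mp z)\<^sup>2) has_derivative (\<lambda>w. (fst w + k * snd w) * (2 * mp z))) (at z)"
      "((\<lambda>z. (mm z)\<^sup>2) has_derivative (\<lambda>w. (- fst w + k * snd w) * (2 * mm z))) (at z)" for z
      unfolding mp_def mm_def
      by (rule DERIV_compose_FDERIV[OF pos_part_square_has_derivative];
          auto intro!: derivative_eq_intros)+
    have C1\<psi>: "C1_on (UNIV \<times> {a<..<b}) \<psi> \<psi>x \<psi>t"
      unfolding C1_on_def
    proof (intro conjI ballI)
      have cx: "continuous_on S \<phi>x" "continuous_on S \<phi>t" for S
        using C1 by (auto simp: C1_on_def intro: continuous_on_subset)
      show "continuous_on (UNIV \<times> {a<..<b}) \<psi>x"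
        unfolding \<psi>x_def by (intro continuous_intros cx cont_m)
      show "continuous_on (UNIV \<times> {a<..<b}) \<psi>t"
        unfolding \<psi>t_def by (intro continuous_intros cx cont_m) auto
      fix z :: "real \<times> real" assume z: "z \<in> UNIV \<times> {a<..<b}"
      have "(\<phi> has_derivative (\<lambda>(k, s). \<phi>x z * k + \<phi>t z * s)) (at z)"
        using C1 unfolding C1_on_def by blast
      moreover have "((\<lambda>z. \<eta> / (b - snd z)) has_derivative (\<lambda>w. snd w * (\<eta> / (b - snd z)\<^sup>2))) (at z)"
      proof (rule DERIV_compose_FDERIV[where f = "\<lambda>s. \<eta> / (b - s)"])
        show "((\<lambda>s. \<eta> / (b - s)) has_real_derivative \<eta> / (b - snd z)\<^sup>2) (at (snd z))"
          using z by (auto intro!: derivative_eq_intros simp: power2_eq_square)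
      qed (auto intro!: derivative_eq_intros)
      ultimately have "(\<psi> has_derivative (\<lambda>w. (case w of (k, s) \<Rightarrow> \<phi>x z * k + \<phi>t z * s)
          - \<Lambda> * ((fst w + k * snd w) * (2 * mp z) + (- fst w + k * snd w) * (2 * mm z))
          - snd w * (\<eta> / (b - snd z)\<^sup>2))) (at z)"
        unfolding \<psi>_def by (intro has_derivative_diff has_derivative_add has_derivative_mult_right deriv_m)
      also have "(\<lambda>w. (case w of (k, s) \<Rightarrow> \<phi>x z * k + \<phi>t z * s)
          - \<Lambda> * ((fst w + k * snd w) * (2 * mp z) + (- fst w + k * snd w) * (2 * mm z))
          - snd w * (\<eta> / (b - snd z)\<^sup>2)) = (\<lambda>(k, s). \<psi>x z * k + \<psi>t z * s)"
        by (auto simp: fun_eq_iff \<psi>x_def \<psi>t_def algebra_simps)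
      finally show "(\<psi> has_derivative (\<lambda>(k, s). \<psi>x z * k + \<psi>t z * s)) (at z)" .
    qed
    define Q where "Q = {x - R - 1..x + R + 1} \<times> {a..b - e}"
    have "compact Q" unfolding Q_def by (intro compact_Times) auto
    moreover have xrQ: "(x, r) \<in> Q" using r e R0 by (auto simp: Q_def field_simps)
    moreover have "continuous_on Q (\<lambda>z. v z - \<psi> z)"
      unfolding \<psi>_def using e
      by (intro continuous_intros cont_m cont\<phi> continuous_on_subset[OF cont])
        (auto simp: Q_def)
    ultimately have "\<exists>z\<in>Q. \<forall>z'\<in>Q. v z - \<psi> z \<le> v z' - \<psi> z'"
      by (intro continuous_attains_inf) auto
    then obtain z where zQ: "z \<in> Q" and zmin: "\<And>z'. z' \<in> Q \<Longrightarrow> v z - \<psi> z \<le> v z' - \<psi> z'"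
      by blast
    obtain y s where z: "z = (y, s)" by (cases z)
    have ys: "x - R - 1 \<le> y" "y \<le> x + R + 1" "a \<le> s" "s \<le> b - e"
      using zQ by (auto simp: z Q_def)
    have \<eta>s: "\<eta> / (b - s) > 0" using ys e \<eta> by simp
    have "mp (x, r) = 0" "mm (x, r) = 0"
      using kR[of r] r by (auto simp: mp_def mm_def)
    moreover have "\<eta> / (b - r) < \<phi> (x, r) - v (x, r)"
      using r neg by (simp add: \<eta>_def pos_divide_less_eq)
    ultimately have "v (x, r) - \<psi> (x, r) < 0"
      by (simp add: \<psi>_def)
    then have "v z - \<psi> z < 0" using zmin[OF xrQ] by linarith
    then have F: "v z - \<phi> z + \<Lambda> * ((mp z)\<^sup>2 + (mm z)\<^sup>2) + \<eta> / (b - s) < 0"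
      by (simp add: \<psi>_def z)
    have pos: "\<Lambda> * ((mp z)\<^sup>2 + (mm z)\<^sup>2) \<ge> 0" using \<Lambda> by simp
    have lower: "v z - \<phi> z \<ge> - \<Lambda>"
      using bnd[of y s] ys e z by fastforce
    \<comment> \<open>A negative minimum cannot lie on the boundary of \<open>Q\<close>: the initial
      inequality excludes the bottom, the barrier the top, and the penalty the two sides.\<close>
    have "s \<noteq> a"
      using F pos \<eta>s init[of y] by (auto simp: z)
    moreover have "s \<noteq> b - e"
      using F pos lower \<eta>e by auto
    moreover have "(mp z)\<^sup>2 + (mm z)\<^sup>2 < 1"
    proof (rule ccontr)
      assume "\<not> (mp z)\<^sup>2 + (mm z)\<^sup>2 < 1"
      then have "\<Lambda> * 1 \<le> \<Lambda> * ((mp z)\<^sup>2 + (mm z)\<^sup>2)"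
        using \<Lambda> by (intro mult_left_mono) auto
      with F lower \<eta>s show False by linarith
    qed
    then have small: "mp z < 1" "mm z < 1"
      by (smt (verit) one_le_power zero_le_power2)+
    moreover have "0 \<le> k * (s - a)" using k0 ys by simp
    ultimately have int: "x - R - 1 < y" "y < x + R + 1" "a < s" "s < b - e"
      using ys by (auto simp: mp_def mm_def z)
    have "\<forall>\<^sub>F z' in nhds z. z' \<in> {x - R - 1<..<x + R + 1} \<times> {a<..<b - e}"
      using int by (intro eventually_nhds_in_open open_Times) (auto simp: z)
    then have "has_local_min (\<lambda>z. v z - \<psi> z) z"
      unfolding has_local_min_def
      by eventually_elim (rule zmin, auto simp: Q_def)
    with super C1\<psi> int e have "H (\<psi>x z) * c \<le> \<psi>t z"
      unfolding viscosity_supersolution_def by (auto simp: z)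
    moreover have "\<phi>t z \<le> H (\<phi>x z) * c"
      using sub[of s y] int e by (simp add: z)
    \<comment> \<open>The penalty moves at speed \<open>k\<close>, so the amount by which it lowers
      the time derivative pays for the change of the Hamiltonian due to its slope. The time
      derivative of the barrier is then left over and contradicts the supersolution
      inequality.\<close>
    moreover have "(H (\<phi>x z) - H (\<psi>x z)) * c \<le> 2 * \<Lambda> * k * (mp z + mm z)"
    proof -
      have m: "\<bar>mp z - mm z\<bar> \<le> mp z + mm z"
        by (simp add: mp_def mm_def)
      have "(H (\<phi>x z) - H (\<psi>x z)) * c \<le> \<bar>H (\<phi>x z) - H (\<psi>x z)\<bar> * \<bar>c\<bar>"
        by (metis abs_ge_self abs_mult)
      also have "\<dots> \<le> K * \<bar>2 * \<Lambda> * (mp z - mm z)\<bar> * \<bar>c\<bar>"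
        using lip[of "\<phi>x z" "\<psi>x z"] by (intro mult_right_mono) (auto simp: \<psi>x_def)
      also have "\<dots> = 2 * \<Lambda> * k * \<bar>mp z - mm z\<bar>"
        using \<Lambda> by (simp add: abs_mult k_def)
      also have "\<dots> \<le> 2 * \<Lambda> * k * (mp z + mm z)"
        using m \<Lambda> k0 by (intro mult_left_mono) auto
      finally show ?thesis .
    qed
    moreover have "\<eta> / (b - s)\<^sup>2 > 0" using \<eta> ys e by simp
    ultimately show False
      by (simp add: \<psi>t_def z algebra_simps)
  qed
  \<comment> \<open>The end times \<open>a\<close> and \<open>b\<close> are reached from the open
    interval by continuity.\<close>
  have "continuous_on (closure {a<..<b}) (\<lambda>s. \<phi> (x, s) - v (x, s))"
    using \<open>a < b\<close>
    by (auto intro!: continuous_intros continuous_on_compose2[OF cont\<phi>[of UNIV]]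
        continuous_on_compose2[OF cont])
  then have "\<phi> (x, t) - v (x, t) \<le> 0"
    by (rule continuous_le_on_closure) (use t \<open>a < b\<close> inner in auto)
  then show ?thesis by simp
qed

section \<open>One time step of the scheme\<close>

text \<open>Under the CFL condition \<open>cfl\<close> the step is monotone, so \<open>w\<close> may
  be replaced by the paraboloid above it. On a paraboloid the centred difference quotient is the
  exact derivative, and the second difference is the constant \<open>h\<^sup>2 / \<delta>\<close>,
  which produces the last error term.\<close>

lemma scheme_step_le_paraboloid:
  fixes H w :: "real \<Rightarrow> real"
  assumes lip: "\<And>p q. \<bar>H p - H q\<bar> \<le> K * \<bar>p - q\<bar>"
    and \<theta>: "0 \<le> \<theta>" "\<theta> \<le> 1" and "0 < h" and "0 < \<delta>"
    and cfl: "K * \<bar>\<zeta> t - \<zeta> s\<bar> \<le> \<theta> * h"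
    and w: "\<And>x. w x \<le> A + (x - y)\<^sup>2 / (2 * \<delta>)"
  shows "scheme_step H \<theta> h \<zeta> t s w x
    \<le> A + (x - y)\<^sup>2 / (2 * \<delta>) + H ((x - y) / \<delta>) * (\<zeta> t - \<zeta> s) + \<theta> * h\<^sup>2 / (2 * \<delta>)"
proof -
  define P where "P x = A + (x - y)\<^sup>2 / (2 * \<delta>)" for x
  define \<tau> where "\<tau> = \<zeta> t - \<zeta> s"
  define dp where "dp = P (x + h) - w (x + h)"
  define dm where "dm = P (x - h) - w (x - h)"
  have d: "dp \<ge> 0" "dm \<ge> 0" "P x - w x \<ge> 0"
    using w by (auto simp: dp_def dm_def P_def)
  have slope: "(P (x + h) - P (x - h)) / (2 * h) = (x - y) / \<delta>"
    using \<open>0 < h\<close> \<open>0 < \<delta>\<close> by (simp add: P_def power2_eq_square field_simps)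
  have curv: "P (x + h) + P (x - h) - 2 * P x = h\<^sup>2 / \<delta>"
    using \<open>0 < \<delta>\<close> by (simp add: P_def power2_eq_square field_simps)
  define q where "q = (w (x + h) - w (x - h)) / (2 * h)"
  \<comment> \<open>The slopes of \<open>w\<close> and of the paraboloid differ only through the two
    gaps at \<open>x + h\<close> and \<open>x - h\<close>. By \<open>cfl\<close> the resulting
    change of the Hamiltonian term is at most \<open>\<theta> / 2 * (dp + dm)\<close>, exactly what
    the diffusion term gains from these gaps.\<close>
  have q: "q - (x - y) / \<delta> = (dm - dp) / (2 * h)"
    unfolding slope[symmetric] q_def dp_def dm_def
    by (simp add: diff_divide_distrib add_divide_distrib)
  have "(H q - H ((x - y) / \<delta>)) * \<tau> \<le> \<bar>H q - H ((x - y) / \<delta>)\<bar> * \<bar>\<tau>\<bar>"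
    by (metis abs_ge_self abs_mult)
  also have "\<dots> \<le> K * \<bar>(dm - dp) / (2 * h)\<bar> * \<bar>\<tau>\<bar>"
    using lip[of q "(x - y) / \<delta>"] by (intro mult_right_mono) (auto simp: q)
  also have "\<dots> = (K * \<bar>\<tau>\<bar>) * (\<bar>dm - dp\<bar> / (2 * h))"
    using \<open>0 < h\<close> by simp
  also have "\<dots> \<le> (\<theta> * h) * (\<bar>dm - dp\<bar> / (2 * h))"
    using cfl \<open>0 < h\<close> by (intro mult_right_mono) (auto simp: \<tau>_def)
  also have "\<dots> = \<theta> / 2 * \<bar>dm - dp\<bar>"
    using \<open>0 < h\<close> by simp
  also have "\<dots> \<le> \<theta> / 2 * (dp + dm)"
    using d \<theta> by (intro mult_left_mono) auto
  finally have "H q * \<tau> \<le> H ((x - y) / \<delta>) * \<tau> + \<theta> / 2 * (dp + dm)"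
    by (simp only: left_diff_distrib)
  \<comment> \<open>The centre value enters the step with weight \<open>1 - \<theta>\<close>; here
    \<theta> \<le> 1 is essential for monotonicity.\<close>
  moreover have "0 \<le> (1 - \<theta>) * (P x - w x)"
    using d \<theta> by simp
  ultimately have "scheme_step H \<theta> h \<zeta> t s w x \<le>
      P x + H ((x - y) / \<delta>) * \<tau> + \<theta> / 2 * (P (x + h) + P (x - h) - 2 * P x)"
    by (simp add: scheme_step_def q_def \<tau>_def dp_def dm_def algebra_simps)
  then show ?thesis
    unfolding curv by (simp add: P_def \<tau>_def)
qed

text \<open>For fixed \<open>x\<close>, the hypothesis says that \<open>v\<close> lies above a function of \<open>y\<close> which
  the equation transports, up to an error quadratic in the increment of \<open>\<zeta>\<close>, into the paraboloid
  of the conclusion.\<close>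

lemma scheme_step_minus_supersolution_le:
  fixes H H' w \<zeta> :: "real \<Rightarrow> real" and v :: "real \<times> real \<Rightarrow> real"
  assumes DH: "\<And>p. (H has_real_derivative H' p) (at p)" and contH': "continuous_on UNIV H'"
    and H'K: "\<And>p. \<bar>H' p\<bar> \<le> K"
    and \<theta>: "0 \<le> \<theta>" "\<theta> \<le> 1" and "0 < h" and "0 < \<delta>" and "a < b"
    and cfl: "K * (\<bar>c\<bar> * (b - a)) \<le> \<theta> * h"
    and cont: "continuous_on (UNIV \<times> {a..b}) v"
    and super: "viscosity_supersolution H c a b v"
    and init: "\<And>x y. w x - v (y, a) \<le> M + (x - y)\<^sup>2 / (2 * \<delta>)"
    and t: "t \<in> {a..b}" and \<zeta>: "\<zeta> t - \<zeta> a = c * (t - a)"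
  shows "scheme_step H \<theta> h \<zeta> t a w x - v (y, t)
    \<le> M + 3 / 2 * h\<^sup>2 / \<delta> + (x - y)\<^sup>2 / (2 * \<delta>)"
proof -
  have K0: "K \<ge> 0" using H'K[of 0] by simp
  have lip: "\<bar>H p - H q\<bar> \<le> K * \<bar>p - q\<bar>" for p q
    using field_differentiable_bound[of UNIV H H' K p q] DH H'K by simp
  have cfl': "K * \<bar>\<zeta> t - \<zeta> a\<bar> \<le> \<theta> * h"
  proof -
    have "K * \<bar>\<zeta> t - \<zeta> a\<bar> \<le> K * (\<bar>c\<bar> * (b - a))"
      using t K0 unfolding \<zeta> by (intro mult_left_mono) (auto simp: abs_mult intro!: mult_left_mono)
    with cfl show ?thesis by linarith
  qed
  \<comment> \<open>\<open>A\<close> is fixed so that the paraboloid bound on the step becomes the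
    initial inequality for \<open>\<phi>\<close>, while \<open>\<phi> (y, t) \<le> v (y, t)\<close>
    becomes the conclusion up to \<open>E * (t - a)\<close> and the diffusion error.\<close>
  define A where "A = scheme_step H \<theta> h \<zeta> t a w x - M - \<theta> * h\<^sup>2 / (2 * \<delta>)"
  \<comment> \<open>In \<open>\<phi>\<close> the Hamiltonian is evaluated at the slope
    \<open>(x - y) / \<delta>\<close> of the paraboloid instead of the true slope
    \<open>\<phi>x\<close>. The two differ by at most
    \<open>K * \<bar>c\<bar> * (b - a) / \<delta>\<close>, and one more factor
    \<open>K * \<bar>c\<bar>\<close> gives the rate \<open>E\<close> that makes
    \<open>\<phi>\<close> a subsolution.\<close>
  define E where "E = K\<^sup>2 * c\<^sup>2 * (b - a) / \<delta>"
  define \<phi> where "\<phi> z = A - (x - fst z)\<^sup>2 / (2 * \<delta>)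
    - H ((x - fst z) / \<delta>) * (c * (t - snd z)) - E * (snd z - a)" for z :: "real \<times> real"
  define \<phi>x where "\<phi>x z = (x - fst z) / \<delta> + H' ((x - fst z) / \<delta>) * (c * (t - snd z)) / \<delta>"
    for z :: "real \<times> real"
  define \<phi>t where "\<phi>t z = H ((x - fst z) / \<delta>) * c - E" for z :: "real \<times> real"
  have "\<phi> (y, t) \<le> v (y, t)"
  proof (rule C1_subsolution_le_supersolution[OF lip cont super _ _ _ \<open>a < b\<close> t])
    have contH: "continuous_on UNIV H"
      using DH by (meson DERIV_isCont continuous_at_imp_continuous_on)
    have Hz: "((\<lambda>z. H ((x - fst z) / \<delta>)) has_derivative
        (\<lambda>w. (- fst w / \<delta>) * H' ((x - fst z) / \<delta>))) (at z)" for z :: "real \<times> real"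
      using \<open>0 < \<delta>\<close> by (intro DERIV_compose_FDERIV[OF DH]) (auto intro!: derivative_eq_intros)
    show "C1_on UNIV \<phi> \<phi>x \<phi>t"
      unfolding C1_on_def
    proof (intro conjI ballI)
      show "continuous_on UNIV \<phi>x" "continuous_on UNIV \<phi>t"
        unfolding \<phi>x_def \<phi>t_def using \<open>0 < \<delta>\<close>
        by (auto intro!: continuous_intros continuous_on_compose2[OF contH]
            continuous_on_compose2[OF contH'])
      fix z :: "real \<times> real"
      show "(\<phi> has_derivative (\<lambda>(k, s). \<phi>x z * k + \<phi>t z * s)) (at z)"
      proof -
        have "((\<lambda>z. (x - fst z)\<^sup>2 / (2 * \<delta>)) has_derivative (\<lambda>w. - fst w * ((x - fst z) / \<delta>))) (at z)"
        proof (rule DERIV_compose_FDERIV[where f = "\<lambda>r. (x - r)\<^sup>2 / (2 * \<delta>)", THEN has_derivative_eq_rhs])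
          show "((\<lambda>r. (x - r)\<^sup>2 / (2 * \<delta>)) has_real_derivative - ((x - fst z) / \<delta>)) (at (fst z))"
            using \<open>0 < \<delta>\<close> by (auto intro!: derivative_eq_intros simp: field_simps)
          show "(fst has_derivative fst) (at z)" by (auto intro!: derivative_eq_intros)
        qed (simp add: fun_eq_iff)
        moreover have "((\<lambda>z. c * (t - snd z)) has_derivative (\<lambda>w. - c * snd w)) (at z)"
          "((\<lambda>z. E * (snd z - a)) has_derivative (\<lambda>w. E * snd w)) (at z)"
          by (auto intro!: derivative_eq_intros)
        ultimately have "(\<phi> has_derivative (\<lambda>w. 0 - (- fst w * ((x - fst z) / \<delta>))
            - (H ((x - fst z) / \<delta>) * (- c * snd w)
               + (- fst w / \<delta>) * H' ((x - fst z) / \<delta>) * (c * (t - snd z)))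
            - E * snd w)) (at z)"
          unfolding \<phi>_def
          by (intro has_derivative_diff has_derivative_mult has_derivative_const Hz)
        also have "(\<lambda>w. 0 - (- fst w * ((x - fst z) / \<delta>))
            - (H ((x - fst z) / \<delta>) * (- c * snd w)
               + (- fst w / \<delta>) * H' ((x - fst z) / \<delta>) * (c * (t - snd z)))
            - E * snd w) = (\<lambda>(k, s). \<phi>x z * k + \<phi>t z * s)"
          using \<open>0 < \<delta>\<close> by (auto simp: fun_eq_iff \<phi>x_def \<phi>t_def field_simps)
        finally show ?thesis .
      qed
    qed
  next
    fix y' s assume s: "a < s" "s < b"
    define q where "q = (x - y') / \<delta>"
    \<comment> \<open>The time \<open>t\<close> is fixed while the comparison runs over the whole
      interval, so \<open>s\<close> may lie on either side of \<open>t\<close>.\<close>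
    have "\<bar>t - s\<bar> \<le> b - a" using s t by auto
    then have "\<bar>H' q * (c * (t - s)) / \<delta>\<bar> \<le> K * (\<bar>c\<bar> * (b - a)) / \<delta>"
      using H'K[of q] \<open>0 < \<delta>\<close>
      by (auto simp: abs_mult intro!: divide_right_mono mult_mono mult_left_mono)
    then have "\<bar>q - \<phi>x (y', s)\<bar> \<le> K * (\<bar>c\<bar> * (b - a)) / \<delta>"
      by (simp add: \<phi>x_def q_def)
    then have "K * \<bar>q - \<phi>x (y', s)\<bar> \<le> K * (K * (\<bar>c\<bar> * (b - a)) / \<delta>)"
      using K0 by (rule mult_left_mono)
    with lip have "\<bar>H q - H (\<phi>x (y', s))\<bar> \<le> K * (K * (\<bar>c\<bar> * (b - a)) / \<delta>)"
      by (rule order_trans)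
    then have "\<bar>H q - H (\<phi>x (y', s))\<bar> * \<bar>c\<bar> \<le> K * (K * (\<bar>c\<bar> * (b - a)) / \<delta>) * \<bar>c\<bar>"
      by (intro mult_right_mono) auto
    moreover have "K * (K * (\<bar>c\<bar> * (b - a)) / \<delta>) * \<bar>c\<bar> = E"
      by (simp add: E_def power2_eq_square)
    moreover have "(H q - H (\<phi>x (y', s))) * c \<le> \<bar>H q - H (\<phi>x (y', s))\<bar> * \<bar>c\<bar>"
      by (metis abs_ge_self abs_mult)
    ultimately have "(H q - H (\<phi>x (y', s))) * c \<le> E"
      by linarith
    then show "\<phi>t (y', s) \<le> H (\<phi>x (y', s)) * c"
      by (simp add: \<phi>t_def q_def algebra_simps)
  next
    fix y'
    have "w x' \<le> (M + v (y', a)) + (x' - y')\<^sup>2 / (2 * \<delta>)" for x'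
      using init[of x' y'] by simp
    then have "scheme_step H \<theta> h \<zeta> t a w x \<le> M + v (y', a) + (x - y')\<^sup>2 / (2 * \<delta>)
        + H ((x - y') / \<delta>) * (\<zeta> t - \<zeta> a) + \<theta> * h\<^sup>2 / (2 * \<delta>)"
      using lip \<theta> \<open>0 < h\<close> \<open>0 < \<delta>\<close> cfl' by (intro scheme_step_le_paraboloid[of H K])
    then show "\<phi> (y', a) \<le> v (y', a)"
      by (simp add: \<phi>_def A_def \<zeta>)
  qed
  \<comment> \<open>By the CFL condition the accumulated residual is at most
    \<open>h\<^sup>2 / \<delta>\<close>; the diffusion error adds at most half of this, whence the
    factor \<open>3 / 2\<close>.\<close>
  moreover have "E * (t - a) \<le> h\<^sup>2 / \<delta>"
  proof -
    have "E * (t - a) \<le> E * (b - a)"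
      using t \<open>0 < \<delta>\<close> \<open>a < b\<close> by (intro mult_left_mono) (auto simp: E_def)
    also have "\<dots> = (K * (\<bar>c\<bar> * (b - a)))\<^sup>2 / \<delta>"
      by (simp add: E_def power2_eq_square)
    also have "\<dots> \<le> (\<theta> * h)\<^sup>2 / \<delta>"
      using cfl K0 \<open>a < b\<close> \<open>0 < \<delta>\<close> by (intro divide_right_mono power_mono) auto
    also have "\<dots> \<le> (1 * h)\<^sup>2 / \<delta>"
      using \<theta> \<open>0 < h\<close> \<open>0 < \<delta>\<close> by (intro divide_right_mono power_mono mult_right_mono) auto
    finally show ?thesis by simp
  qed
  moreover have "\<theta> * h\<^sup>2 / (2 * \<delta>) \<le> 1 * h\<^sup>2 / (2 * \<delta>)"
    using \<theta> \<open>0 < \<delta>\<close> by (intro divide_right_mono mult_right_mono) auto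
  ultimately show ?thesis
    by (simp add: \<phi>_def A_def field_simps)
qed

section \<open>Iteration over the partition\<close>

text \<open>The inequality with doubled space variable passes from node to node by induction, and
  setting \<open>y = x\<close> at the end removes the quadratic term.\<close>

lemma scheme_minus_supersolution_le:
  fixes H H' u0 \<zeta> :: "real \<Rightarrow> real" and v :: "real \<times> real \<Rightarrow> real"
  assumes DH: "\<And>p. (H has_real_derivative H' p) (at p)" and contH': "continuous_on UNIV H'"
    and H'K: "\<And>p. \<bar>H' p\<bar> \<le> K"
    and \<theta>: "0 \<le> \<theta>" "\<theta> \<le> 1" and "0 < h" and "0 < T"
    and u0: "L-lipschitz_on UNIV u0"
    and P: "is_partition T N p" and aff: "affine_on_partition N p \<zeta>"
    and cfl: "\<And>n. n < N \<Longrightarrow> K * \<bar>\<zeta> (p (Suc n)) - \<zeta> (p n)\<bar> \<le> \<theta> * h"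
    and cont: "continuous_on (UNIV \<times> {0..T}) v" and v0: "\<And>x. v (x, 0) = u0 x"
    and super: "\<And>n. n < N \<Longrightarrow> viscosity_supersolution H
        ((\<zeta> (p (Suc n)) - \<zeta> (p n)) / (p (Suc n) - p n)) (p n) (p (Suc n)) v"
    and t: "t \<in> {0..T}"
  shows "scheme H \<theta> h \<zeta> p u0 (x, t) - v (x, t) \<le> (L\<^sup>2 / 2 + 3 / 2) * (sqrt (real N) * h)"
proof -
  have pN: "p 0 = 0" "p N = T" using P by (auto simp: is_partition_def)
  have "N > 0" using pN \<open>0 < T\<close> by (cases N) auto
  \<comment> \<open>This choice balances the initial error, of order \<open>\<delta>\<close>,
    against the sum of N step errors, of order \<open>N * h\<^sup>2 / \<delta>\<close>.\<close>
  define \<delta> where "\<delta> = sqrt (real N) * h"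
  have \<delta>: "\<delta> > 0" using \<open>N > 0\<close> \<open>0 < h\<close> by (simp add: \<delta>_def)
  define M where "M n = L\<^sup>2 * \<delta> / 2 + real n * (3 / 2 * h\<^sup>2 / \<delta>)" for n
  have M_mono: "M m \<le> M n" if "m \<le> n" for m n
    using that \<delta> unfolding M_def by (intro add_left_mono mult_right_mono) auto
  \<comment> \<open>Stated for every time in the interval, so that it serves both for the induction
    over the nodes and for the final passage to an arbitrary \<open>t\<close>.\<close>
  have step: "scheme H \<theta> h \<zeta> p u0 (x, t) - v (y, t) \<le> M (Suc n) + (x - y)\<^sup>2 / (2 * \<delta>)"
    if n: "n < N" and t: "p n < t" "t \<le> p (Suc n)"
      and IH: "\<And>x y. scheme H \<theta> h \<zeta> p u0 (x, p n) - v (y, p n) \<le> M n + (x - y)\<^sup>2 / (2 * \<delta>)"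
    for n t x y
  proof -
    let ?c = "(\<zeta> (p (Suc n)) - \<zeta> (p n)) / (p (Suc n) - p n)"
    have pn: "p n < p (Suc n)" using P n by (auto simp: is_partition_def)
    have sub: "{p n..p (Suc n)} \<subseteq> {0..T}"
      using partition_mono[OF P, of 0 n] partition_mono[OF P, of "Suc n" N] n pN by auto
    obtain \<alpha> \<beta> where ab: "\<And>t. t \<in> {p n..p (Suc n)} \<Longrightarrow> \<zeta> t = \<alpha> * t + \<beta>"
      using aff n unfolding affine_on_partition_def by blast
    have "\<zeta> (p (Suc n)) - \<zeta> (p n) = \<alpha> * (p (Suc n) - p n)"
      using ab pn by (simp add: algebra_simps)
    then have c: "?c = \<alpha>" using pn by simp
    have "\<zeta> t - \<zeta> (p n) = ?c * (t - p n)"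
      unfolding c using ab pn t by (simp add: algebra_simps)
    moreover have "K * (\<bar>?c\<bar> * (p (Suc n) - p n)) \<le> \<theta> * h"
      using cfl[OF n] pn by simp
    moreover have "continuous_on (UNIV \<times> {p n..p (Suc n)}) v"
      by (rule continuous_on_subset[OF cont]) (use sub in auto)
    ultimately have "scheme_step H \<theta> h \<zeta> t (p n) (\<lambda>x. scheme H \<theta> h \<zeta> p u0 (x, p n)) x - v (y, t)
        \<le> M n + 3 / 2 * h\<^sup>2 / \<delta> + (x - y)\<^sup>2 / (2 * \<delta>)"
      using t by (intro scheme_step_minus_supersolution_le[OF DH contH' H'K \<theta> \<open>0 < h\<close> \<delta> pn _ _ super[OF n] IH]) auto
    moreover have "M (Suc n) = M n + 3 / 2 * h\<^sup>2 / \<delta>"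
      by (simp only: M_def of_nat_Suc distrib_right mult_1_left)
    ultimately show ?thesis
      using scheme_recursion[OF P n] t by simp
  qed
  have init: "scheme H \<theta> h \<zeta> p u0 (x, p 0) - v (y, p 0) \<le> M 0 + (x - y)\<^sup>2 / (2 * \<delta>)" for x y
  proof -
    have "u0 x - u0 y \<le> L * \<bar>x - y\<bar>"
      using lipschitz_onD[OF u0, of x y] by (simp add: dist_real_def)
    \<comment> \<open>Young's inequality trades the Lipschitz bound for a paraboloid.\<close>
    also have "\<dots> \<le> L\<^sup>2 * \<delta> / 2 + (x - y)\<^sup>2 / (2 * \<delta>)"
    proof -
      have "0 \<le> (L * \<delta> - \<bar>x - y\<bar>)\<^sup>2 / (2 * \<delta>)" using \<delta> by simp
      also have "\<dots> = L\<^sup>2 * \<delta> / 2 + (x - y)\<^sup>2 / (2 * \<delta>) - L * \<bar>x - y\<bar>"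
        using \<delta> by (simp add: power2_diff power_mult_distrib field_simps power2_eq_square)
      finally show ?thesis by simp
    qed
    finally show ?thesis
      using v0 pN scheme_initial[of H \<theta> h \<zeta> p u0 x] by (simp add: M_def)
  qed
  have nodes: "n \<le> N \<Longrightarrow>
      scheme H \<theta> h \<zeta> p u0 (x, p n) - v (y, p n) \<le> M n + (x - y)\<^sup>2 / (2 * \<delta>)" for n x y
  proof (induction n arbitrary: x y)
    case 0
    show ?case by (rule init)
  next
    case (Suc n)
    have "p n < p (Suc n)" using P Suc.prems by (auto simp: is_partition_def)
    then show ?case using Suc by (intro step) auto
  qed
  have "scheme H \<theta> h \<zeta> p u0 (x, t) - v (x, t) \<le> M N"
  proof (cases "t = 0")
    case True
    then show ?thesis
      using init[of x x] pN M_mono[of 0 N] by simp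
  next
    case False
    define n where "n = (LEAST n. t \<le> p (Suc n))"
    have "Suc (N - 1) = N" using \<open>N > 0\<close> by simp
    then have ex: "t \<le> p (Suc (N - 1))" using pN t by simp
    have n: "t \<le> p (Suc n)" "n < N"
      unfolding n_def using LeastI[where P = "\<lambda>n. t \<le> p (Suc n)", OF ex]
        Least_le[where P = "\<lambda>n. t \<le> p (Suc n)", OF ex] \<open>N > 0\<close> by auto
    have "p n < t"
    proof (cases n)
      case 0
      then show ?thesis using pN t False by simp
    next
      case (Suc m)
      then show ?thesis
        using not_less_Least[of m "\<lambda>n. t \<le> p (Suc n)"] by (auto simp: n_def)
    qed
    then have "scheme H \<theta> h \<zeta> p u0 (x, t) - v (x, t) \<le> M (Suc n) + (x - x)\<^sup>2 / (2 * \<delta>)"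
      using n nodes by (intro step) auto
    then show ?thesis using M_mono[of "Suc n" N] n by simp
  qed
  also have "M N = (L\<^sup>2 / 2 + 3 / 2) * \<delta>"
  proof -
    have "real N * h\<^sup>2 = \<delta> * \<delta>"
      by (simp add: \<delta>_def power2_eq_square)
    then have "real N * (3 / 2 * h\<^sup>2 / \<delta>) = 3 / 2 * \<delta>"
      using \<delta> by (simp add: field_simps)
    then show ?thesis
      by (simp add: M_def algebra_simps)
  qed
  finally show ?thesis by (simp add: \<delta>_def)
qed

section \<open>Reflection and the two-sided estimate\<close>

text \<open>The diffusion term is linear, and the two sign changes in the Hamiltonian turn its value
  at the negated slope into minus the original one. The upper estimate for the reflected problem is
  therefore the lower estimate for the original one.\<close>

lemma scheme_minus:
  "scheme (\<lambda>p. - H (- p)) \<theta> h \<zeta> p (\<lambda>x. - u0 x) z = - scheme H \<theta> h \<zeta> p u0 z"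
proof -
  have step: "scheme_step (\<lambda>p. - H (- p)) \<theta> h \<zeta> t s (\<lambda>x. - w x) = (\<lambda>x. - scheme_step H \<theta> h \<zeta> t s w x)"
    for t s w
  proof
    fix x
    have "- ((- w (x + h) - - w (x - h)) / (2 * h)) = (w (x + h) - w (x - h)) / (2 * h)"
      by (simp add: divide_simps)
    then show "scheme_step (\<lambda>p. - H (- p)) \<theta> h \<zeta> t s (\<lambda>x. - w x) x = - scheme_step H \<theta> h \<zeta> t s w x"
      unfolding scheme_step_def by (simp only:) (simp add: algebra_simps)
  qed
  have "scheme_at_node (\<lambda>p. - H (- p)) \<theta> h \<zeta> p (\<lambda>x. - u0 x) n =
      (\<lambda>x. - scheme_at_node H \<theta> h \<zeta> p u0 n x)" for n
    by (induction n) (simp_all add: step)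
  then show ?thesis
    by (cases z) (simp add: scheme_def Let_def step)
qed

text \<open>A test function touching \<open>- v\<close> from below becomes, after negation, one
  touching \<open>v\<close> from above, with both partial derivatives negated.\<close>

lemma viscosity_supersolution_minus:
  assumes "viscosity_subsolution H c a b v"
  shows "viscosity_supersolution (\<lambda>p. - H (- p)) c a b (\<lambda>z. - v z)"
  unfolding viscosity_supersolution_def
proof (intro allI impI, elim conjE)
  fix \<phi> \<phi>x \<phi>t :: "real \<times> real \<Rightarrow> real" and z
  assume C1: "C1_on (UNIV \<times> {a<..<b}) \<phi> \<phi>x \<phi>t" and z: "z \<in> UNIV \<times> {a<..<b}"
    and min: "has_local_min (\<lambda>y. - v y - \<phi> y) z"
  have "C1_on (UNIV \<times> {a<..<b}) (\<lambda>z. - \<phi> z) (\<lambda>z. - \<phi>x z) (\<lambda>z. - \<phi>t z)"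
    unfolding C1_on_def
  proof (intro conjI ballI)
    fix z :: "real \<times> real" assume "z \<in> UNIV \<times> {a<..<b}"
    then have "(\<phi> has_derivative (\<lambda>(k, s). \<phi>x z * k + \<phi>t z * s)) (at z)"
      using C1 by (auto simp: C1_on_def)
    from has_derivative_minus[OF this]
    show "((\<lambda>z. - \<phi> z) has_derivative (\<lambda>(k, s). - \<phi>x z * k + - \<phi>t z * s)) (at z)"
      by (simp add: case_prod_unfold)
  qed (use C1 in \<open>auto simp: C1_on_def intro!: continuous_on_minus\<close>)
  moreover have "has_local_max (\<lambda>y. v y - - \<phi> y) z"
    using min by (auto simp: has_local_min_def has_local_max_def algebra_simps elim: eventually_mono)
  ultimately have "- \<phi>t z \<le> H (- \<phi>x z) * c"
    using assms z unfolding viscosity_subsolution_def by blast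
  then show "- H (- \<phi>x z) * c \<le> \<phi>t z" by simp
qed

theorem theorem1p2:
  fixes H :: "real \<Rightarrow> real" and \<theta> L :: real
  assumes "smooth H" and "bounded (range (deriv H))"
    and "0 < \<theta>" and "\<theta> \<le> 1"
    and "0 < L"
  shows "\<exists>C>0. \<forall>(T::real) (u0 :: real \<Rightarrow> real) (h::real) (N::nat) (p :: nat \<Rightarrow> real)
           (\<zeta> :: real \<Rightarrow> real) (v :: real \<times> real \<Rightarrow> real) (\<epsilon>::real).
      0 < T \<longrightarrow>
      bounded (range u0) \<longrightarrow> L-lipschitz_on UNIV u0 \<longrightarrow>
      0 < h \<longrightarrow>
      is_partition T N p \<longrightarrow>
      continuous_on {0..T} \<zeta> \<longrightarrow> affine_on_partition N p \<zeta> \<longrightarrow>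
      (sup_norm (deriv H) \<noteq> 0 \<longrightarrow>
         (MAX n\<in>{..<N}. \<bar>\<zeta> (p (Suc n)) - \<zeta> (p n)\<bar>) \<le> \<theta> / sup_norm (deriv H) * h) \<longrightarrow>
      is_viscosity_solution H \<zeta> N p u0 v \<longrightarrow>
      0 < \<epsilon> \<longrightarrow>
      (SUP z\<in>UNIV \<times> {0..T}. ereal \<bar>scheme H \<theta> h \<zeta> p u0 z - v z\<bar>)
        \<le> ereal (1 / \<epsilon> * (\<Sum>n<N. (p (Suc n) - p n)\<^sup>2) + C * sqrt (real N) * h
             + (SUP (s, t)\<in>{0..T} \<times> {0..T}. C * \<bar>\<zeta> s - \<zeta> t\<bar> - \<bar>s - t\<bar>\<^sup>2 / (2 * \<epsilon>)))"
proof (intro exI[of _ "L\<^sup>2 / 2 + 3 / 2"] conjI allI impI)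
  show "L\<^sup>2 / 2 + 3 / 2 > 0" by (simp add: add_nonneg_pos)
  fix T h :: real and u0 N p \<zeta> v and \<epsilon> :: real
  assume "0 < T" and "bounded (range u0)" and u0: "L-lipschitz_on UNIV u0" and "0 < h"
    and P: "is_partition T N p" and cont\<zeta>: "continuous_on {0..T} \<zeta>"
    and aff: "affine_on_partition N p \<zeta>"
    and cfl: "sup_norm (deriv H) \<noteq> 0 \<longrightarrow>
         (MAX n\<in>{..<N}. \<bar>\<zeta> (p (Suc n)) - \<zeta> (p n)\<bar>) \<le> \<theta> / sup_norm (deriv H) * h"
    and v: "is_viscosity_solution H \<zeta> N p u0 v" and "0 < \<epsilon>"
  define K where "K = sup_norm (deriv H)"
  \<comment> \<open>The first summand stems from the Lipschitz bound on the initial data, the second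
    from the error per time step.\<close>
  define C where "C = L\<^sup>2 / 2 + 3 / 2"
  have diff: "(deriv ^^ k) H differentiable_on UNIV" for k
    using \<open>smooth H\<close> by (simp add: smooth_def)
  have DH: "(H has_real_derivative deriv H q) (at q)" for q
    using diff[of 0] by (simp add: DERIV_deriv_iff_real_differentiable differentiable_on_def)
  have contH': "continuous_on UNIV (deriv H)"
    using diff[of 1] by (simp add: differentiable_imp_continuous_on)
  have H'K: "\<bar>deriv H q\<bar> \<le> K" for q
    unfolding K_def sup_norm_def
  proof (rule cSUP_upper)
    show "bdd_above (range (\<lambda>x. \<bar>deriv H x\<bar>))"
      using assms(2) by (auto simp: bounded_iff bdd_above_def)
  qed simp
  have K0: "K \<ge> 0" using H'K[of 0] by simp
  have cfl': "K * \<bar>\<zeta> (p (Suc n)) - \<zeta> (p n)\<bar> \<le> \<theta> * h" if "n < N" for n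
  \<comment> \<open>For \<open>K = 0\<close> the step condition of the theorem says nothing, but the
    left side of the claim vanishes.\<close>
  proof (cases "K = 0")
    case True
    then show ?thesis using assms \<open>0 < h\<close> by simp
  next
    case False
    have "\<bar>\<zeta> (p (Suc n)) - \<zeta> (p n)\<bar> \<le> (MAX n\<in>{..<N}. \<bar>\<zeta> (p (Suc n)) - \<zeta> (p n)\<bar>)"
      using that by (intro Max_ge) auto
    also have "\<dots> \<le> \<theta> / K * h" using cfl False by (simp add: K_def)
    finally show ?thesis using False K0 by (simp add: field_simps)
  qed
  have pN: "p 0 = 0" "p N = T" using P by (auto simp: is_partition_def)
  have contv: "continuous_on (UNIV \<times> {0..T}) v" and v0: "\<And>x. v (x, 0) = u0 x"
    and sub: "\<And>n. n < N \<Longrightarrow> viscosity_subsolution H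
        ((\<zeta> (p (Suc n)) - \<zeta> (p n)) / (p (Suc n) - p n)) (p n) (p (Suc n)) v"
    and super: "\<And>n. n < N \<Longrightarrow> viscosity_supersolution H
        ((\<zeta> (p (Suc n)) - \<zeta> (p n)) / (p (Suc n) - p n)) (p n) (p (Suc n)) v"
    using v by (auto simp: is_viscosity_solution_def Let_def pN)
  have err: "\<bar>scheme H \<theta> h \<zeta> p u0 (x, t) - v (x, t)\<bar> \<le> C * sqrt (real N) * h"
    if t: "t \<in> {0..T}" for x t
  proof -
    have \<theta>: "0 \<le> \<theta>" "\<theta> \<le> 1" using assms by auto
    have "scheme H \<theta> h \<zeta> p u0 (x, t) - v (x, t) \<le> C * (sqrt (real N) * h)"
      unfolding C_def
      by (rule scheme_minus_supersolution_le[OF DH contH' H'K \<theta> \<open>0 < h\<close> \<open>0 < T\<close> u0 P aff cfl'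
            contv v0 super t])
    \<comment> \<open>The reflected Hamiltonian has derivative \<open>deriv H (- q)\<close>, hence
      the same bound \<open>K\<close> and the same CFL condition; the subsolution property of
      \<open>v\<close> now supplies the supersolution.\<close>
    moreover have "scheme (\<lambda>p. - H (- p)) \<theta> h \<zeta> p (\<lambda>x. - u0 x) (x, t) - - v (x, t)
        \<le> C * (sqrt (real N) * h)"
      unfolding C_def
    proof (rule scheme_minus_supersolution_le[OF _ _ _ \<theta> \<open>0 < h\<close> \<open>0 < T\<close> _ P aff cfl' _ _ _ t,
          where H' = "\<lambda>q. deriv H (- q)"])
      show "((\<lambda>p. - H (- p)) has_real_derivative deriv H (- q)) (at q)" for q
        by (auto intro!: derivative_eq_intros DERIV_chain2[OF DH])
      show "continuous_on UNIV (\<lambda>q. deriv H (- q))"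
        by (intro continuous_on_compose2[OF contH'] continuous_intros) auto
      show "L-lipschitz_on UNIV (\<lambda>x. - u0 x)"
        using u0 by simp
      show "continuous_on (UNIV \<times> {0..T}) (\<lambda>z. - v z)"
        by (intro continuous_on_minus contv)
    qed (use H'K v0 sub viscosity_supersolution_minus in auto)
    ultimately show ?thesis by (simp add: scheme_minus abs_le_iff mult.assoc)
  qed
  \<comment> \<open>The supremum of \<open>?g\<close> is nonnegative because \<open>?g\<close>
    vanishes at \<open>(0, 0)\<close>. Continuity on a compact square gives the boundedness without
    which a real supremum could not be compared with this value.\<close>
  let ?g = "\<lambda>(s, t). C * \<bar>\<zeta> s - \<zeta> t\<bar> - \<bar>s - t\<bar>\<^sup>2 / (2 * \<epsilon>)"
  have "continuous_on ({0..T} \<times> {0..T}) ?g"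
    unfolding case_prod_beta using \<open>0 < \<epsilon>\<close>
    by (intro continuous_intros continuous_on_compose2[OF cont\<zeta>]) auto
  then have "bdd_above (?g ` ({0..T} \<times> {0..T}))"
    by (intro bounded_imp_bdd_above compact_imp_bounded compact_continuous_image compact_Times) auto
  then have "?g (0, 0) \<le> (SUP z\<in>{0..T} \<times> {0..T}. ?g z)"
    using \<open>0 < T\<close> by (intro cSUP_upper) auto
  moreover have "0 \<le> 1 / \<epsilon> * (\<Sum>n<N. (p (Suc n) - p n)\<^sup>2)"
    using \<open>0 < \<epsilon>\<close> by (simp add: sum_nonneg)
  ultimately have "C * sqrt (real N) * h \<le> 1 / \<epsilon> * (\<Sum>n<N. (p (Suc n) - p n)\<^sup>2)
      + C * sqrt (real N) * h + (SUP z\<in>{0..T} \<times> {0..T}. ?g z)"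
    by simp
  then have "ereal \<bar>scheme H \<theta> h \<zeta> p u0 z - v z\<bar> \<le> ereal (1 / \<epsilon> * (\<Sum>n<N. (p (Suc n) - p n)\<^sup>2)
      + C * sqrt (real N) * h + (SUP z\<in>{0..T} \<times> {0..T}. ?g z))" if "z \<in> UNIV \<times> {0..T}" for z
    using err[of "snd z" "fst z"] that unfolding ereal_less_eq by (cases z) (fastforce elim: order_trans)
  then show "(SUP z\<in>UNIV \<times> {0..T}. ereal \<bar>scheme H \<theta> h \<zeta> p u0 z - v z\<bar>)
        \<le> ereal (1 / \<epsilon> * (\<Sum>n<N. (p (Suc n) - p n)\<^sup>2) + (L\<^sup>2 / 2 + 3 / 2) * sqrt (real N) * h
             + (SUP (s, t)\<in>{0..T} \<times> {0..T}.
                 (L\<^sup>2 / 2 + 3 / 2) * \<bar>\<zeta> s - \<zeta> t\<bar> - \<bar>s - t\<bar>\<^sup>2 / (2 * \<epsilon>)))"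
    unfolding C_def[symmetric] by (rule SUP_least)
qed

end
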